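(* For any integers $s,t\ge 1$, with $d=\gcd(s,t)$, one has the identity of formal power series $$C_{s(t)}(q)=\frac{(q^d;q^d)_\infty^d}{(q;q)_\infty}\,\Big(C_{(s/d)(t/d)}(q^d)\Big)^d,$$ where $C_{(s/d)(t/d)}(q^d)$ denotes the series $C_{s'(t')}(q)$ with $s'=s/d$, $t'=t/d$, evaluated at $q^d$ in place of $q$.
   Context: A partition of $n$ is a nonincreasing sequence of positive integers summing to $n$ (its size); the empty partition has size $0$. The hooklength of a box in the Young diagram of a partition is the number of boxes directly to its right plus the number of boxes directly below it plus $1$. For integers $s,t\ge 1$ (with $s>t$ or $s=t$ allowed), an $s \pmod t$-core is a partition having no hook whose length lies in $\{s,s+t,s+2t,s+3t,\dots\}$. Let $c_{s(t)}(n)$ be the number of $s \pmod t$-cores of size $n$, and $C_{s(t)}(q)=\sum_{n=0}^\infty c_{s(t)}(n)q^n$. Notation: $(A;q)_\infty=(1-A)(1-Aq)(1-Aq^2)\cdots$, so $(q^k;q^k)_\infty=\prod_{i\ge1}(1-q^{ki})$. *)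

theory Defs
  imports "HOL-Analysis.Analysis"
begin

definition is_partition :: "nat list \<Rightarrow> bool" where
  "is_partition xs \<longleftrightarrow> sorted_wrt (\<ge>) xs \<and> (\<forall>x\<in>set xs. x > 0)"

text \<open>The box \<open>(i, j)\<close> lies in row \<open>i\<close> and column \<open>j\<close>, both counted from 0.\<close>

definition young_diagram :: "nat list \<Rightarrow> (nat \<times> nat) set" where
  "young_diagram xs = {(i, j). i < length xs \<and> j < xs ! i}"

definition hook_length :: "nat list \<Rightarrow> nat \<times> nat \<Rightarrow> nat" where
  "hook_length xs = (\<lambda>(i, j).
     card {j'. j' > j \<and> (i, j') \<in> young_diagram xs} +
     card {i'. i' > i \<and> (i', j) \<in> young_diagram xs} + 1)"

definition is_mod_core :: "nat \<Rightarrow> nat \<Rightarrow> nat list \<Rightarrow> bool" where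
  "is_mod_core s t xs \<longleftrightarrow> is_partition xs \<and>
     (\<forall>b\<in>young_diagram xs. hook_length xs b \<notin> {s + k * t | k. True})"

definition num_mod_cores :: "nat \<Rightarrow> nat \<Rightarrow> nat \<Rightarrow> nat" where
  "num_mod_cores s t n = card {xs. is_mod_core s t xs \<and> sum_list xs = n}"

text \<open>Rational coefficients are used because division of formal power series in the
  library needs an inverse on the coefficients.\<close>

definition mod_core_gf :: "nat \<Rightarrow> nat \<Rightarrow> rat fps" where
  "mod_core_gf s t = Abs_fps (\<lambda>n. of_nat (num_mod_cores s t n))"

text \<open>\<open>(A; q)\<^sub>\<infinity>\<close>, as an infinite product converging in the
  metric of formal power series.\<close>

definition qpoch_inf :: "rat fps \<Rightarrow> rat fps \<Rightarrow> rat fps" where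
  "qpoch_inf A q = (\<Prod>i. 1 - A * q ^ i)"

text \<open>The set counted by \<^const>\<open>num_mod_cores\<close> is finite, so its cardinality is not the
  default value 0 of infinite sets.\<close>

lemma finite_mod_cores: "finite {xs. is_mod_core s t xs \<and> sum_list xs = n}"
proof (rule finite_subset)
  have len: "length xs \<le> sum_list xs" if "\<forall>x\<in>set xs. x > 0" for xs :: "nat list"
    using that by (induction xs) (auto simp: Suc_le_eq)
  show "{xs. is_mod_core s t xs \<and> sum_list xs = n} \<subseteq>
          {xs. set xs \<subseteq> {..n} \<and> length xs \<le> n}"
    using len by (auto simp: is_mod_core_def is_partition_def intro: member_le_sum_list)
  show "finite {xs. set xs \<subseteq> {..n} \<and> length xs \<le> n}"
    by (rule finite_lists_length_le) simp
qed

text \<open>The products used below converge, and their limits have constant coefficient 1, so that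
  they may be divided by.\<close>

lemma qpoch_inf_fps_X_power:
  assumes "k > 0"
  shows "(\<lambda>i. 1 - fps_X ^ k * (fps_X ^ k) ^ i :: rat fps) has_prod
           qpoch_inf (fps_X ^ k) (fps_X ^ k)" (is "?f has_prod _")
    and "fps_nth (qpoch_inf (fps_X ^ k) (fps_X ^ k)) 0 = 1"
proof -
  define P where "P n = (\<Prod>i\<le>n. ?f i)" for n
  define L where "L = Abs_fps (\<lambda>m. fps_nth (P m) m)"
  have f: "?f i = 1 - fps_X ^ (k * Suc i)" for i
    by (simp only: power_mult power_Suc)
  have PSuc: "P (Suc n) = P n - fps_X ^ (k * Suc (Suc n)) * P n" for n
  proof -
    have "P (Suc n) = P n * ?f (Suc n)"
      unfolding P_def by (rule prod.atMost_Suc)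
    also have "\<dots> = P n * (1 - fps_X ^ (k * Suc (Suc n)))"
      by (simp only: f)
    finally show ?thesis
      by (simp only: right_diff_distrib mult_1_left mult_1_right mult.commute)
  qed
  have lt: "m < k * Suc (Suc n)" if "m \<le> n" for m n
  proof -
    have "m < 1 * Suc (Suc n)" using that by simp
    also have "\<dots> \<le> k * Suc (Suc n)" using assms by (intro mult_right_mono) auto
    finally show ?thesis .
  qed
  have step: "fps_nth (P (Suc n)) m = fps_nth (P n) m" if "m \<le> n" for m n
    using lt[OF that] by (simp only: PSuc fps_sub_nth fps_X_power_mult_nth if_True diff_zero)
  have stab: "fps_nth (P n) m = fps_nth (P m) m" if "m \<le> n" for m n
    using that by (induction n rule: dec_induct) (simp_all only: step)
  have "P \<longlonglongrightarrow> L"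
  proof (rule tendsto_fpsI)
    fix m show "eventually (\<lambda>n. fps_nth (P n) m = fps_nth L m) sequentially"
      using eventually_ge_at_top[of m]
      by eventually_elim (unfold L_def fps_nth_Abs_fps, rule stab)
  qed
  moreover have L0: "fps_nth L 0 = 1"
    using assms unfolding L_def P_def by simp
  moreover from L0 have "L \<noteq> 0"
    by force
  ultimately have L: "?f has_prod L"
    unfolding has_prod_def raw_has_prod_def P_def add_0_right by (intro disjI1 conjI)
  moreover have "qpoch_inf (fps_X ^ k) (fps_X ^ k) = L"
    unfolding qpoch_inf_def by (rule has_prod_unique[OF L, symmetric])
  ultimately show "?f has_prod qpoch_inf (fps_X ^ k) (fps_X ^ k)"
    and "fps_nth (qpoch_inf (fps_X ^ k) (fps_X ^ k)) 0 = 1"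
    using L0 by (simp_all only:)
qed

end

theory Submission
  imports Defs "HOL-Computational_Algebra.Formal_Laurent_Series"
begin

text \<open>
  A partition \<open>\<lambda>\<close> together with a charge \<open>c\<close> is encoded by its Maya diagram
  \<open>M = {\<lambda>\<^sub>i - i + c | i \<ge> 1}\<close>, a set of integers. The hook lengths of \<open>\<lambda>\<close> are the differences
  \<open>x - y > 0\<close> with \<open>x \<in> M\<close>, \<open>y \<notin> M\<close>, and the size of \<open>\<lambda>\<close> is the regularised sum of the elements of
  \<open>M\<close>, up to a constant depending on \<open>c\<close>. Splitting \<open>M\<close> into residue classes modulo \<open>d\<close> gives
  \<open>d\<close> Maya diagrams with charges \<open>c\<^sub>r\<close> of sum 0 and partitions \<open>\<lambda>\<^sub>r\<close>; hooks of length \<open>d h\<close> in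
  \<open>\<lambda>\<close> correspond to hooks of length \<open>h\<close> in the \<open>\<lambda>\<^sub>r\<close>, and \<open>|\<lambda>|\<close> is \<open>d (|\<lambda>\<^sub>0| + \<dots> + |\<lambda>\<^sub>d\<^sub>-\<^sub>1|)\<close> plus a
  term depending only on the charges. Hence, for every set \<open>H\<close> of lengths, the generating function of the
  partitions without hooks in \<open>d H\<close> is \<open>K(q) F\<^sub>H(q\<^sup>d)\<^sup>d\<close>, where \<open>F\<^sub>H\<close> is that of the partitions without
  hooks in \<open>H\<close> and \<open>K\<close> does not depend on \<open>H\<close>. All lengths \<open>s + k t\<close> are multiples of \<open>d\<close>, and
  \<open>H = {}\<close> together with Euler's product for the partition generating function determines \<open>K\<close>.
\<close>

section \<open>Weight generating functions\<close>

definition weight_gf :: "'a set \<Rightarrow> ('a \<Rightarrow> nat) \<Rightarrow> rat fps" where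
  "weight_gf A w = Abs_fps (\<lambda>n. of_nat (card {a \<in> A. w a = n}))"

text \<open>\<open>card\<close> is 0 on infinite sets, so the product rule for
  \<open>weight_gf\<close> requires this condition.\<close>

definition finite_fibers :: "'a set \<Rightarrow> ('a \<Rightarrow> nat) \<Rightarrow> bool" where
  "finite_fibers A w \<longleftrightarrow> (\<forall>n. finite {a \<in> A. w a = n})"

lemma bij_betw_fibers:
  assumes "bij_betw f A B" and "\<And>a. a \<in> A \<Longrightarrow> w' (f a) = w a"
  shows "bij_betw f {a \<in> A. w a = n} {b \<in> B. w' b = n}"
  using assms unfolding bij_betw_def by (auto intro: inj_on_subset)

lemma weight_gf_bij:
  assumes "bij_betw f A B" and "\<And>a. a \<in> A \<Longrightarrow> w' (f a) = w a"
  shows "weight_gf A w = weight_gf B w'"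
  unfolding weight_gf_def using bij_betw_same_card[OF bij_betw_fibers[of f A B w' w, OF assms]] by simp

lemma finite_fibers_bij:
  assumes "bij_betw f A B" and "\<And>a. a \<in> A \<Longrightarrow> w' (f a) = w a" and "finite_fibers A w"
  shows "finite_fibers B w'"
  using bij_betw_finite[OF bij_betw_fibers[of f A B w' w, OF assms(1,2)]] assms(3)
  by (simp add: finite_fibers_def)

lemma finite_fibers_inj:
  assumes "inj_on f A" and "f ` A \<subseteq> B" and "\<And>a. a \<in> A \<Longrightarrow> w' (f a) = w a"
    and "finite_fibers B w'"
  shows "finite_fibers A w"
  unfolding finite_fibers_def
proof
  fix n
  show "finite {a \<in> A. w a = n}"
  proof (rule inj_on_finite)
    show "inj_on f {a \<in> A. w a = n}" using assms(1) by (rule inj_on_subset) auto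
    show "f ` {a \<in> A. w a = n} \<subseteq> {b \<in> B. w' b = n}" using assms(2,3) by auto
    show "finite {b \<in> B. w' b = n}" using assms(4) by (simp add: finite_fibers_def)
  qed
qed

text \<open>A pair of weight \<open>n\<close> has components of weights \<open>i\<close> and
  \<open>n - i\<close>; counting these disjoint rectangles gives the Cauchy product.\<close>

lemma
  assumes "finite_fibers A u" and "finite_fibers B v"
  shows weight_gf_times: "weight_gf (A \<times> B) (\<lambda>(a, b). u a + v b) = weight_gf A u * weight_gf B v"
    and finite_fibers_times: "finite_fibers (A \<times> B) (\<lambda>(a, b). u a + v b)"
proof -
  have eq: "{p \<in> A \<times> B. (case p of (a, b) \<Rightarrow> u a + v b) = n} =
      (\<Union>i\<in>{0..n}. {a \<in> A. u a = i} \<times> {b \<in> B. v b = n - i})" for n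
    by auto
  have fin: "finite {a \<in> A. u a = i}" "finite {b \<in> B. v b = i}" for i
    using assms by (auto simp: finite_fibers_def)
  show "finite_fibers (A \<times> B) (\<lambda>(a, b). u a + v b)"
    unfolding finite_fibers_def eq using fin by auto
  have "card (\<Union>i\<in>{0..n}. {a \<in> A. u a = i} \<times> {b \<in> B. v b = n - i}) =
      (\<Sum>i=0..n. card {a \<in> A. u a = i} * card {b \<in> B. v b = n - i})" for n
    using fin by (subst card_UN_disjoint) (auto simp: card_cartesian_product)
  then show "weight_gf (A \<times> B) (\<lambda>(a, b). u a + v b) = weight_gf A u * weight_gf B v"
    unfolding weight_gf_def eq by (intro fps_ext) (simp add: fps_mult_nth)
qed

text \<open>Splitting off one coordinate reduces the claim to pairs. Both parts share one induction,
  since the product rule needs finiteness for the shorter tuples.\<close>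

lemma weight_gf_PiE:
  assumes "finite_fibers A w"
  shows "weight_gf (PiE {..<k} (\<lambda>_. A)) (\<lambda>f. \<Sum>r<k. w (f r)) = weight_gf A w ^ k \<and>
    finite_fibers (PiE {..<k} (\<lambda>_. A)) (\<lambda>f. \<Sum>r<k. w (f r))"
proof (induction k)
  case 0
  show ?case
    by (auto simp: weight_gf_def finite_fibers_def fps_eq_iff)
next
  case (Suc k)
  let ?P = "\<lambda>k. PiE {..<k} (\<lambda>_. A)" and ?W = "\<lambda>k f. \<Sum>r<k. w (f r)"
  let ?g = "\<lambda>(y, f). f(k := y)"
  have bij: "bij_betw ?g (A \<times> ?P k) (?P (Suc k))"
    unfolding bij_betw_def lessThan_Suc PiE_insert_eq
    using inj_combinator[of k "{..<k}" "\<lambda>_. A"] by simp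
  have w: "?W (Suc k) (?g p) = (case p of (y, f) \<Rightarrow> w y + ?W k f)" if "p \<in> A \<times> ?P k" for p
    by (auto split: prod.splits)
  have fin: "finite_fibers (A \<times> ?P k) (\<lambda>(y, f). w y + ?W k f)"
    using Suc assms by (intro finite_fibers_times) auto
  have "weight_gf (?P (Suc k)) (?W (Suc k)) = weight_gf (A \<times> ?P k) (\<lambda>(y, f). w y + ?W k f)"
    by (rule sym, rule weight_gf_bij[where f = ?g], rule bij, rule w)
  also have "\<dots> = weight_gf A w ^ Suc k"
    using Suc assms by (subst weight_gf_times) auto
  finally have 1: "weight_gf (?P (Suc k)) (?W (Suc k)) = weight_gf A w ^ Suc k" .
  have "finite_fibers (?P (Suc k)) (?W (Suc k))"
    by (rule finite_fibers_bij[where f = ?g], rule bij, rule w, assumption, rule fin)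
  with 1 show ?case by blast
qed

lemma weight_gf_scale:
  assumes "d > 0"
  shows "weight_gf A (\<lambda>a. d * w a) = weight_gf A w oo fps_X ^ d"
proof (rule fps_ext)
  fix n
  have "{a \<in> A. d * w a = n} = (if d dvd n then {a \<in> A. w a = n div d} else {})"
    using assms by auto
  then show "fps_nth (weight_gf A (\<lambda>a. d * w a)) n = fps_nth (weight_gf A w oo fps_X ^ d) n"
    using assms by (simp add: weight_gf_def fps_nth_compose_X_power)
qed

lemma finite_fibers_scale:
  assumes "finite_fibers A w" "d > 0"
  shows "finite_fibers A (\<lambda>a. d * w a)"
  unfolding finite_fibers_def
proof
  fix n
  have "{a \<in> A. d * w a = n} \<subseteq> {a \<in> A. w a = n div d}" using assms by auto
  then show "finite {a \<in> A. d * w a = n}"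
    using assms(1) finite_subset unfolding finite_fibers_def by blast
qed

section \<open>Euler's product\<close>

text \<open>Coefficient \<open>n\<close> of a product involves only coefficients up to
  \<open>n\<close> of the factors, and for large \<open>N\<close> the partial product and
  \<open>Q N\<close> agree with their limits there.\<close>

lemma qpoch_inf_times_eq_1:
  fixes Q :: "nat \<Rightarrow> rat fps"
  assumes "k > 0"
    and "\<And>N. (\<Prod>i<N. 1 - (fps_X ^ k) ^ Suc i) * Q N = 1"
    and "\<And>N n. n \<le> N \<Longrightarrow> fps_nth (Q N) n = fps_nth L n"
  shows "qpoch_inf (fps_X ^ k) (fps_X ^ k) * L = 1"
proof (rule fps_ext)
  fix n
  define F where "F N = (\<Prod>i\<le>N. 1 - fps_X ^ k * (fps_X ^ k) ^ i :: rat fps)" for N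
  have "F \<longlonglongrightarrow> qpoch_inf (fps_X ^ k) (fps_X ^ k)"
    using has_prod_imp_tendsto[OF qpoch_inf_fps_X_power(1)[OF assms(1)]]
    unfolding F_def .
  then have "\<forall>m. \<forall>\<^sub>F N in sequentially. fps_nth (F N) m = fps_nth (qpoch_inf (fps_X ^ k) (fps_X ^ k)) m"
    by (simp add: tendsto_fps_iff)
  then have "\<forall>\<^sub>F N in sequentially. \<forall>m\<in>{..n}. fps_nth (F N) m = fps_nth (qpoch_inf (fps_X ^ k) (fps_X ^ k)) m"
    by (intro eventually_ball_finite) auto
  then obtain N0 where N0: "\<And>N m. N \<ge> N0 \<Longrightarrow> m \<le> n \<Longrightarrow>
      fps_nth (F N) m = fps_nth (qpoch_inf (fps_X ^ k) (fps_X ^ k)) m"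
    unfolding eventually_sequentially by blast
  define N where "N = max n N0"
  have "N \<ge> n" and N: "\<And>m. m \<le> n \<Longrightarrow> fps_nth (F N) m = fps_nth (qpoch_inf (fps_X ^ k) (fps_X ^ k)) m"
    using N0 by (auto simp: N_def)
  have "fps_nth (qpoch_inf (fps_X ^ k) (fps_X ^ k) * L) n = fps_nth (F N * Q (Suc N)) n"
    unfolding fps_mult_nth using N assms(3) \<open>N \<ge> n\<close> by (intro sum.cong) auto
  \<comment> \<open>\<open>F N\<close> has \<open>Suc N\<close> factors, hence the index of
    \<open>Q\<close>.\<close>
  also have "F N * Q (Suc N) = 1"
    using assms(2)[of "Suc N"] by (simp add: F_def lessThan_Suc_atMost)
  finally show "fps_nth (qpoch_inf (fps_X ^ k) (fps_X ^ k) * L) n = fps_nth 1 n" .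
qed

section \<open>Partitions with bounded parts\<close>

definition bounded_partitions :: "nat \<Rightarrow> nat list set" where
  "bounded_partitions N = {xs. is_partition xs \<and> (\<forall>x\<in>set xs. x \<le> N)}"

lemma is_partition_Cons:
  "is_partition (x # xs) \<longleftrightarrow> x > 0 \<and> (\<forall>y\<in>set xs. y \<le> x) \<and> is_partition xs"
  by (auto simp: is_partition_def)

lemma is_partition_Nil [simp]: "is_partition []"
  by (simp add: is_partition_def)

lemma finite_fibers_partition: "finite_fibers {xs. is_partition xs} sum_list"
proof -
  \<comment> \<open>With \<open>s = t = 0\<close> only length 0 is forbidden, and hook lengths are
    at least 1; so \<open>finite_mod_cores\<close> speaks about all partitions.\<close>
  have "is_mod_core 0 0 xs \<longleftrightarrow> is_partition xs" for xs
    by (auto simp: is_mod_core_def hook_length_def)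
  then show ?thesis
    using finite_mod_cores[of 0 0] by (simp add: finite_fibers_def)
qed

text \<open>Either no part equals \<open>Suc N\<close>, or the first one does and can be removed;
  further copies may remain, hence the same set on the right.\<close>

lemma bounded_partitions_Suc:
  "bounded_partitions (Suc N) = bounded_partitions N \<union> (#) (Suc N) ` bounded_partitions (Suc N)"
proof (intro subset_antisym subsetI)
  fix xs assume xs: "xs \<in> bounded_partitions (Suc N)"
  show "xs \<in> bounded_partitions N \<union> (#) (Suc N) ` bounded_partitions (Suc N)"
  proof (cases xs)
    case Nil
    then show ?thesis by (simp add: bounded_partitions_def)
  next
    case (Cons x ys)
    show ?thesis
    proof (cases "x = Suc N")
      case True
      then show ?thesis using xs Cons by (auto simp: bounded_partitions_def is_partition_Cons)
    next
      case False
      then have "x \<le> N" using xs Cons by (simp add: bounded_partitions_def)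
      then show ?thesis
        using xs Cons by (auto simp: bounded_partitions_def is_partition_Cons intro: le_trans)
    qed
  qed
qed (auto simp: bounded_partitions_def is_partition_Cons)

lemma weight_gf_bounded_partitions:
  "(\<Prod>i<N. 1 - fps_X ^ Suc i) * weight_gf (bounded_partitions N) sum_list = 1"
proof (induction N)
  case 0
  have "bounded_partitions 0 = {[]}"
  proof -
    have "xs = []" if "is_partition xs" "\<forall>x\<in>set xs. x = 0" for xs
      using that by (cases xs) (auto simp: is_partition_def)
    then show ?thesis by (auto simp: bounded_partitions_def)
  qed
  moreover have "{xs \<in> {[]}. sum_list xs = n} = (if n = 0 then {[]} else {})" for n :: nat
    by auto
  ultimately show ?case
    by (simp add: weight_gf_def fps_eq_iff)
next
  case (Suc N)
  let ?A = "\<lambda>N n. {xs \<in> bounded_partitions N. sum_list xs = n}"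
  let ?B = "\<lambda>n. {xs \<in> bounded_partitions (Suc N). Suc N + sum_list xs = n}"
  have fin: "finite (?A N n)" for N n
  proof (rule finite_subset)
    show "?A N n \<subseteq> {xs \<in> {xs. is_partition xs}. sum_list xs = n}"
      by (auto simp: bounded_partitions_def)
    show "finite {xs \<in> {xs. is_partition xs}. sum_list xs = n}"
      using finite_fibers_partition by (simp add: finite_fibers_def)
  qed
  have split: "?A (Suc N) n = ?A N n \<union> (#) (Suc N) ` ?B n" for n
    by (subst bounded_partitions_Suc) auto
  have "card (?A (Suc N) n) = card (?A N n) + card ((#) (Suc N) ` ?B n)" for n
  proof (subst split, rule card_Un_disjoint)
    have "finite (?B n)"
      using fin[of "Suc N" "n - Suc N"] by (rule finite_subset[rotated]) auto
    then show "finite ((#) (Suc N) ` ?B n)" by (rule finite_imageI)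
    have "Suc N # xs \<notin> bounded_partitions N" for xs
      by (simp add: bounded_partitions_def)
    then show "?A N n \<inter> (#) (Suc N) ` ?B n = {}" by blast
  qed (rule fin)
  moreover have "card ((#) (Suc N) ` ?B n) = card (?B n)" for n
    by (rule card_image) simp
  moreover have "?B n = (if n < Suc N then {} else ?A (Suc N) (n - Suc N))" for n
    by auto
  ultimately have card: "card (?A (Suc N) n) =
      card (?A N n) + (if n < Suc N then 0 else card (?A (Suc N) (n - Suc N)))" for n
    by simp
  have "weight_gf (bounded_partitions (Suc N)) sum_list =
      weight_gf (bounded_partitions N) sum_list +
      fps_X ^ Suc N * weight_gf (bounded_partitions (Suc N)) sum_list"
  proof (rule fps_ext)
    fix n
    show "fps_nth (weight_gf (bounded_partitions (Suc N)) sum_list) n =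
      fps_nth (weight_gf (bounded_partitions N) sum_list +
        fps_X ^ Suc N * weight_gf (bounded_partitions (Suc N)) sum_list) n"
      unfolding weight_gf_def fps_nth_Abs_fps fps_X_power_mult_nth fps_add_nth card[of n] of_nat_add
      by (simp only: if_distrib[of of_nat] of_nat_0)
  qed
  then have "(1 - fps_X ^ Suc N) * weight_gf (bounded_partitions (Suc N)) sum_list =
      weight_gf (bounded_partitions N) sum_list"
    unfolding left_diff_distrib mult_1_left diff_eq_eq .
  then show ?case
    using Suc.IH by (simp only: prod.lessThan_Suc mult.assoc)
qed

text \<open>A partition of \<open>m\<close> has no part above \<open>m\<close>, so bounding the
  parts by \<open>N\<close> leaves the coefficients up to \<open>N\<close> unchanged. The cases
  \<open>k = 1\<close> and \<open>k = d\<close> enter the final cancellation.\<close>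

lemma qpoch_inf_partition_gf:
  assumes "k > 0"
  shows "qpoch_inf (fps_X ^ k) (fps_X ^ k) *
    (weight_gf {xs. is_partition xs} sum_list oo fps_X ^ k) = 1"
proof (rule qpoch_inf_times_eq_1[OF assms])
  let ?Q = "\<lambda>N. weight_gf (bounded_partitions N) sum_list"
  have X0: "fps_nth (fps_X ^ k :: rat fps) 0 = 0" using assms by simp
  fix N
  have "((\<Prod>i<N. 1 - fps_X ^ Suc i) * ?Q N) oo fps_X ^ k = 1"
    by (simp only: weight_gf_bounded_partitions fps_compose_1)
  then show "(\<Prod>i<N. 1 - (fps_X ^ k) ^ Suc i) * (?Q N oo fps_X ^ k) = 1"
    by (simp only: fps_compose_mult_distrib[OF X0] fps_compose_prod_distrib[OF X0]
        fps_compose_sub_distrib fps_compose_1 fps_X_power_compose[OF X0])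
next
  fix N n :: nat
  assume "n \<le> N"
  have "{xs \<in> bounded_partitions N. sum_list xs = m} = {xs \<in> {xs. is_partition xs}. sum_list xs = m}"
    if "m \<le> N" for m
    using that member_le_sum_list by (fastforce simp: bounded_partitions_def)
  moreover have "n div k \<le> N" using \<open>n \<le> N\<close> div_le_dividend le_trans by blast
  ultimately show "fps_nth (weight_gf (bounded_partitions N) sum_list oo fps_X ^ k) n =
      fps_nth (weight_gf {xs. is_partition xs} sum_list oo fps_X ^ k) n"
    by (simp only: fps_nth_compose_X_power weight_gf_def fps_nth_Abs_fps)
qed

section \<open>Maya diagrams\<close>

definition is_maya :: "int set \<Rightarrow> bool" where
  "is_maya M \<longleftrightarrow> finite (M \<inter> {0..}) \<and> finite ({..<0} - M)"

text \<open>The sum of \<open>g\<close> over \<open>M\<close>, normalised to vanish on the negative integers.\<close>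

definition maya_sum :: "(int \<Rightarrow> int) \<Rightarrow> int set \<Rightarrow> int" where
  "maya_sum g M = sum g (M \<inter> {0..}) - sum g ({..<0} - M)"

abbreviation charge :: "int set \<Rightarrow> int" where
  "charge \<equiv> maya_sum (\<lambda>_. 1)"

abbreviation energy :: "int set \<Rightarrow> int" where
  "energy \<equiv> maya_sum (\<lambda>x. x)"

definition maya_hooks :: "int set \<Rightarrow> nat set" where
  "maya_hooks M = {h. h > 0 \<and> (\<exists>x\<in>M. x - int h \<notin> M)}"

text \<open>\<open>maya c xs\<close> consists of \<open>c + xs ! i - i - 1\<close> for \<open>i < length xs\<close> and of all integers below
  \<open>c - length xs\<close>.\<close>

primrec maya :: "int \<Rightarrow> nat list \<Rightarrow> int set" where
  "maya c [] = {..<c}"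
| "maya c (x # xs) = insert (c + int x - 1) (maya (c - 1) xs)"

section \<open>Charge and energy\<close>

lemma insert_parts:
  fixes x :: int
  shows "insert x M \<inter> {0..} = (if x \<ge> 0 then insert x (M \<inter> {0..}) else M \<inter> {0..})"
    and "{..<0} - insert x M = {..<0} - M - {x}"
  by auto

lemma is_maya_insert [simp]: "is_maya (insert x M) = is_maya M"
  by (auto simp: is_maya_def insert_parts)

text \<open>A nonnegative \<open>x\<close> joins the first sum; a negative one fills a gap and
  leaves the subtracted sum. Either way \<open>g x\<close> is gained.\<close>

lemma maya_sum_insert:
  assumes "is_maya M" "x \<notin> M"
  shows "maya_sum g (insert x M) = maya_sum g M + g x"
proof (cases "x \<ge> 0")
  case True
  moreover have "{..<0} - M - {x} = {..<0} - M" using True by auto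
  ultimately show ?thesis
    using assms by (simp add: maya_sum_def insert_parts is_maya_def)
next
  case False
  then have "x \<in> {..<0} - M" using assms by auto
  with False show ?thesis
    using assms by (simp add: maya_sum_def insert_parts is_maya_def sum_diff1)
qed

lemma is_maya_lessThan [simp]: "is_maya {..<c}"
proof -
  have "{..<c} \<inter> {0..} = {0..<c}" "{..<0} - {..<c} = {c..<0}" by auto
  then show ?thesis by (simp add: is_maya_def)
qed

lemma maya_sum_lessThan: "maya_sum g {..<c} = maya_sum g {..<c - 1} + g (c - 1)"
proof -
  have "{..<c} = insert (c - 1) {..<c - 1}" by auto
  then show ?thesis by (simp add: maya_sum_insert)
qed

lemma charge_lessThan [simp]: "charge {..<c} = c"
proof (induction c rule: int_induct[where k = 0])
  case base
  have "{..<0} \<inter> {0..} = ({}::int set)" by auto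
  then show ?case by (simp add: maya_sum_def)
next
  case (step1 i)
  then show ?case using maya_sum_lessThan[of "\<lambda>_. 1" "i + 1"] by simp
next
  case (step2 i)
  then show ?case using maya_sum_lessThan[of "\<lambda>_. 1" i] by simp
qed

text \<open>Each row lowers the offset \<open>c\<close> by one while the parts weakly decrease.
  Applied to a tail, the bound shows that the head is new and exceeds all later elements.\<close>

lemma maya_less:
  assumes "\<forall>x\<in>set xs. x \<le> b" "is_partition xs" "y \<in> maya c xs"
  shows "y < c + int b"
  using assms
proof (induction xs arbitrary: b c)
  case (Cons x xs)
  then have "y < c - 1 + int x" if "y \<in> maya (c - 1) xs"
    using that Cons.IH[of x "c - 1"] by (simp add: is_partition_Cons)
  with Cons.prems show ?case by (auto simp: is_partition_Cons)
qed auto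

lemma maya_Cons_notin:
  assumes "is_partition (x # xs)"
  shows "c + int x - 1 \<notin> maya (c - 1) xs"
  using maya_less[of xs x _ "c - 1"] assms by (fastforce simp: is_partition_Cons)

lemma is_maya_maya [simp]: "is_maya (maya c xs)"
  by (induction xs arbitrary: c) auto

lemma charge_maya:
  assumes "is_partition xs"
  shows "charge (maya c xs) = c"
  using assms
proof (induction xs arbitrary: c)
  case (Cons x xs)
  then show ?case
    using maya_Cons_notin[of x xs c] by (simp add: is_partition_Cons maya_sum_insert)
qed auto

text \<open>Inserting the head adds \<open>c + x - 1\<close>, while lowering the vacuum to
  \<open>{..<c - 1}\<close> loses \<open>c - 1\<close>; the net gain is the part
  \<open>x\<close>.\<close>

lemma energy_maya:
  assumes "is_partition xs"
  shows "energy (maya c xs) = int (sum_list xs) + energy {..<c}"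
  using assms
proof (induction xs arbitrary: c)
  case (Cons x xs)
  then show ?case
    using maya_Cons_notin[of x xs c] maya_sum_lessThan[of "\<lambda>x. x" c]
    by (simp add: is_partition_Cons maya_sum_insert)
qed auto

section \<open>Maya diagrams as charged partitions\<close>

lemma maya_Cons_le:
  assumes "is_partition (x # xs)" "y \<in> maya c (x # xs)"
  shows "y \<le> c + int x - 1"
  using maya_less[of "x # xs" x y c] assms by (auto simp: is_partition_Cons)

lemma maya_Cons_neq_lessThan:
  assumes "is_partition (x # xs)"
  shows "maya c (x # xs) \<noteq> {..<c}"
proof
  assume "maya c (x # xs) = {..<c}"
  moreover have "c + int x - 1 \<in> maya c (x # xs)" by simp
  ultimately have "c + int x - 1 \<in> {..<c}" by blast
  then show False using assms by (simp add: is_partition_Cons)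
qed

text \<open>The largest element \<open>c + x - 1\<close> reveals the first part, and deleting it
  leaves the diagram of the tail. A nonempty list differs from \<open>[]\<close> by an element at or
  above \<open>c\<close>.\<close>

lemma maya_inject:
  assumes "is_partition xs" "is_partition ys" "maya c xs = maya c ys"
  shows "xs = ys"
  using assms
proof (induction xs arbitrary: c ys)
  case Nil
  then show ?case using maya_Cons_neq_lessThan by (cases ys) (metis maya.simps(1))+
next
  case (Cons x xs)
  then obtain y ys' where ys: "ys = y # ys'"
    using maya_Cons_neq_lessThan by (cases ys) (metis maya.simps(1))+
  have "c + int x - 1 \<in> maya c ys" "c + int y - 1 \<in> maya c (x # xs)"
    using Cons.prems(3) ys by auto
  then have "x = y"
    using maya_Cons_le[of x xs "c + int y - 1" c] maya_Cons_le[of y ys' "c + int x - 1" c]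
      Cons.prems ys by simp
  moreover have "maya (c - 1) xs = maya (c - 1) ys'"
    using Cons.prems ys \<open>x = y\<close> maya_Cons_notin[of x xs c] maya_Cons_notin[of y ys' c]
    by (metis insert_ident maya.simps(2))
  ultimately show ?case using Cons ys by (simp add: is_partition_Cons)
qed

lemma maya_bounds:
  assumes "is_maya M"
  obtains a b where "{..<a} \<subseteq> M" "M \<subseteq> {..<b}"
proof
  let ?A = "{..<0} - M" and ?B = "M \<inter> {0..}"
  have fin: "finite ?A" "finite ?B" using assms by (auto simp: is_maya_def)
  show "{..<Min (insert 0 ?A)} \<subseteq> M"
    using fin by (auto simp: subset_iff)
  show "M \<subseteq> {..<Max (insert 0 ?B) + 1}"
  proof
    fix x assume "x \<in> M"
    then have "x \<le> Max (insert 0 ?B)"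
      using fin by (cases "x \<ge> 0") (auto simp: Max_ge_iff)
    then show "x \<in> {..<Max (insert 0 ?B) + 1}" by simp
  qed
qed

text \<open>Induction on the number of elements with a gap below. Unless \<open>M\<close> is an
  initial segment, its maximum \<open>m\<close> is one of them; deleting it lowers the charge
  \<open>c\<close> by one, and \<open>m\<close> yields the first part
  \<open>m + 1 - c\<close>.\<close>

lemma maya_surj:
  assumes "is_maya M"
  obtains xs where "is_partition xs" "M = maya (charge M) xs"
proof -
  have "\<exists>xs. is_partition xs \<and> M = maya (charge M) xs"
    using assms
  proof (induction "card {x \<in> M. \<exists>y. y < x \<and> y \<notin> M}" arbitrary: M rule: less_induct)
    case less
    obtain a b where ab: "{..<a} \<subseteq> M" "M \<subseteq> {..<b}"
      using maya_bounds less.prems by blast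
    have fin: "finite {x \<in> M. \<exists>y. y < x \<and> y \<notin> M}"
      by (rule finite_subset[of _ "{a..<b}"]) (use ab in force)+
    \<comment> \<open>\<open>a - 1\<close> lies in \<open>M\<close>, so this set is nonempty and its
      maximum is that of \<open>M\<close>.\<close>
    have finM: "finite (M \<inter> {a - 1..})"
      by (rule finite_subset[of _ "{a-1..<b}"]) (use ab in force)+
    define m where "m = Max (M \<inter> {a - 1..})"
    have ne: "M \<inter> {a - 1..} \<noteq> {}" using subsetD[OF ab(1), of "a - 1"] by auto
    have m: "m \<in> M" using Max_in[OF finM ne] by (simp add: m_def)
    have le: "y \<le> m" if "y \<in> M" for y
      using Max_ge[OF finM, of y] Max_in[OF finM ne] that by (cases "y \<ge> a - 1") (auto simp: m_def)
    show ?case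
    proof (cases "M = {..<m + 1}")
      case True
      then have "charge M = m + 1" by (metis charge_lessThan)
      with True show ?thesis by (intro exI[of _ "[]"]) (simp add: is_partition_def)
    next
      case False
      then obtain y where y: "y < m" "y \<notin> M"
        using le m by (metis (no_types, lifting) lessThan_iff subsetI subset_antisym zle_add1_eq_le order_le_less)
      define M' where "M' = M - {m}"
      have M: "M = insert m M'" "m \<notin> M'" using m by (auto simp: M'_def)
      then have M': "is_maya M'" using less.prems by simp
      have c: "charge M = charge M' + 1"
        unfolding M(1) using M' M(2) by (rule maya_sum_insert)
      have "card {x \<in> M'. \<exists>y. y < x \<and> y \<notin> M'} < card {x \<in> M. \<exists>y. y < x \<and> y \<notin> M}"
      proof (rule psubset_card_mono[OF fin])
        have "{x \<in> M'. \<exists>y. y < x \<and> y \<notin> M'} \<subseteq> {x \<in> M. \<exists>y. y < x \<and> y \<notin> M}"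
          using le by (force simp: M'_def)
        moreover have "m \<in> {x \<in> M. \<exists>y. y < x \<and> y \<notin> M}" using m y by blast
        ultimately show "{x \<in> M'. \<exists>y. y < x \<and> y \<notin> M'} \<subset> {x \<in> M. \<exists>y. y < x \<and> y \<notin> M}"
          using M(2) by blast
      qed
      from less.hyps[OF this M'] obtain xs where
        xs: "is_partition xs" "M' = maya (charge M') xs" by blast
      define c where "c = charge M"
      have xs': "M' = maya (c - 1) xs" using xs(2) c by (simp add: c_def)
      \<comment> \<open>So \<open>m + 1 - c\<close> is positive and at least every part of
        \<open>xs\<close>. For empty \<open>xs\<close>, the gap \<open>y\<close> below
        \<open>m\<close> excludes \<open>m = c - 1\<close>.\<close>
      have "m \<ge> c \<and> (\<forall>z\<in>set xs. c + int z - 1 \<le> m)"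
      proof (cases xs)
        case Nil
        then have "M' = {..<c - 1}" using xs' by simp
        then have "m \<ge> c - 1" "m \<noteq> c - 1" using M y le by auto
        with Nil show ?thesis by simp
      next
        case (Cons z zs)
        then have "c - 1 + int z - 1 \<in> M'" using xs' by simp
        then have "c - 1 + int z - 1 < m" using le[of "c - 1 + int z - 1"] M
          by (metis insertI2 order_le_less)
        with Cons xs(1) show ?thesis by (auto simp: is_partition_Cons)
      qed
      then have "is_partition (nat (m + 1 - c) # xs)" "M = maya c (nat (m + 1 - c) # xs)"
        using xs(1) M(1) xs' by (auto simp: is_partition_Cons)
      then show ?thesis unfolding c_def by blast
    qed
  qed
  then show ?thesis using that by blast
qed

text \<open>For a partition, the conjugate partition continued by 0; the columns beyond the first
  row will account for the gaps above the largest element.\<close>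

definition column :: "nat list \<Rightarrow> nat \<Rightarrow> nat" where
  "column xs j = card {i. i < length xs \<and> j < xs ! i}"

lemma column_Cons: "column (x # xs) j = (if j < x then 1 else 0) + column xs j"
proof -
  have "i \<in> {i. i < length (x # xs) \<and> j < (x # xs) ! i} \<longleftrightarrow>
      i \<in> (if j < x then {0} else {}) \<union> Suc ` {i. i < length xs \<and> j < xs ! i}" for i
    by (cases i) auto
  then have "{i. i < length (x # xs) \<and> j < (x # xs) ! i} =
      (if j < x then {0} else {}) \<union> Suc ` {i. i < length xs \<and> j < xs ! i}"
    by blast
  then show ?thesis
    unfolding column_def by (auto simp: card_image card_insert_if)
qed

lemma column_eq_0:
  assumes "\<And>x. x \<in> set xs \<Longrightarrow> x \<le> j"
  shows "column xs j = 0"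
proof -
  have "\<not> j < xs ! i" if "i < length xs" for i
    using assms[OF nth_mem[OF that]] by simp
  then have "{i. i < length xs \<and> j < xs ! i} = {}" by blast
  then show ?thesis by (simp add: column_def)
qed

text \<open>The gaps of the Maya diagram are read off the conjugate partition.\<close>

lemma maya_compl:
  assumes "is_partition xs"
  shows "- maya c xs = range (\<lambda>j. c + int j - int (column xs j))"
  using assms
proof (induction xs arbitrary: c)
  case Nil
  have "y \<in> range (\<lambda>j. c + int j)" if "c \<le> y" for y
    using that by (intro image_eqI[of _ _ "nat (y - c)"]) auto
  then show ?case by (auto simp: column_def)
next
  case (Cons x xs)
  have col0: "column xs j = 0" if "x \<le> j" for j
    using Cons.prems that by (intro column_eq_0) (auto simp: is_partition_Cons)
  have "- maya c (x # xs) = - maya (c - 1) xs - {c + int x - 1}" by auto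
  also have "- maya (c - 1) xs = range (\<lambda>j. c - 1 + int j - int (column xs j))"
    using Cons by (simp add: is_partition_Cons)
  \<comment> \<open>For \<open>j < x\<close> the new row lengthens the column by one, which offsets
    the change of charge. For \<open>j \<ge> x\<close> the columns are empty and the index shifts by
    one; the old value at \<open>j = x\<close> is the removed element.\<close>
  also have "\<dots> - {c + int x - 1} = range (\<lambda>j. c + int j - int (column (x # xs) j))"
  proof (intro subset_antisym subsetI)
    fix y assume "y \<in> range (\<lambda>j. c - 1 + int j - int (column xs j)) - {c + int x - 1}"
    then obtain j where j: "y = c - 1 + int j - int (column xs j)" "y \<noteq> c + int x - 1" by blast
    show "y \<in> range (\<lambda>j. c + int j - int (column (x # xs) j))"
    proof (cases "j < x")
      case True
      then show ?thesis using j by (intro image_eqI[of _ _ j]) (simp_all add: column_Cons)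
    next
      case False
      then show ?thesis using j col0[of j] col0[of "j - 1"]
        by (intro image_eqI[of _ _ "j - 1"]) (auto simp: column_Cons of_nat_diff)
    qed
  next
    fix y assume "y \<in> range (\<lambda>j. c + int j - int (column (x # xs) j))"
    then obtain j where j: "y = c + int j - int (column (x # xs) j)" by blast
    show "y \<in> range (\<lambda>j. c - 1 + int j - int (column xs j)) - {c + int x - 1}"
    proof (cases "j < x")
      case True
      then show ?thesis using j by (auto simp: column_Cons)
    next
      case False
      then show ?thesis using j col0[of j] col0[of "Suc j"]
        by (auto simp: column_Cons intro!: image_eqI[of _ _ "Suc j"])
    qed
  qed
  finally show ?case .
qed

section \<open>Hook lengths\<close>

text \<open>The new element exceeds the whole tail, so it never fills the gap \<open>z - h\<close>
  of a hook from the tail. The first set on the right will be the hooks of the first row.\<close>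

lemma maya_hooks_Cons:
  assumes "is_partition (x # xs)"
  shows "maya_hooks (maya c (x # xs)) =
    {h. h > 0 \<and> c + int x - 1 - int h \<notin> maya c (x # xs)} \<union> maya_hooks (maya (c - 1) xs)"
proof -
  have "z - int h \<noteq> c + int x - 1" if "z \<in> maya (c - 1) xs" for z h
  proof -
    have "z \<le> c + int x - 1" using maya_Cons_le[OF assms, of z c] that by simp
    moreover have "z \<noteq> c + int x - 1" using maya_Cons_notin[OF assms, of c] that by blast
    ultimately show ?thesis by linarith
  qed
  then show ?thesis
    unfolding maya_hooks_def by auto
qed

lemma maya_hooks_lessThan [simp]: "maya_hooks {..<c} = {}"
  by (auto simp: maya_hooks_def)

lemma young_diagram_Cons:
  "young_diagram (x # xs) = Pair 0 ` {..<x} \<union> map_prod Suc id ` young_diagram xs"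
proof -
  have "(i, j) \<in> young_diagram (x # xs) \<longleftrightarrow>
      (i, j) \<in> Pair 0 ` {..<x} \<or> (i, j) \<in> map_prod Suc id ` young_diagram xs" for i j
  proof (cases i)
    case 0
    then show ?thesis by (auto simp: young_diagram_def)
  next
    case (Suc k)
    have "(Suc k, j) \<in> map_prod Suc id ` young_diagram xs \<longleftrightarrow> (k, j) \<in> young_diagram xs"
      by (auto intro: rev_image_eqI)
    with Suc show ?thesis by (auto simp: young_diagram_def)
  qed
  then show ?thesis by (intro set_eqI) (simp add: split_paired_all)
qed

lemma hook_length_Suc: "hook_length (x # xs) (Suc i, j) = hook_length xs (i, j)"
proof -
  have "k \<in> {i'. i' > Suc i \<and> (i', j) \<in> young_diagram (x # xs)} \<longleftrightarrow>
      k \<in> Suc ` {i'. i' > i \<and> (i', j) \<in> young_diagram xs}" for k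
    by (cases k) (auto simp: young_diagram_def)
  then have "{i'. i' > Suc i \<and> (i', j) \<in> young_diagram (x # xs)} =
      Suc ` {i'. i' > i \<and> (i', j) \<in> young_diagram xs}" by blast
  moreover have "{j'. j' > j \<and> (Suc i, j') \<in> young_diagram (x # xs)} =
      {j'. j' > j \<and> (i, j') \<in> young_diagram xs}"
    by (auto simp: young_diagram_def)
  ultimately show ?thesis by (simp add: hook_length_def card_image)
qed

lemma hook_length_0:
  assumes "j < x"
  shows "hook_length (x # xs) (0, j) = x - j + column xs j"
proof -
  have "k \<in> {i'. i' > 0 \<and> (i', j) \<in> young_diagram (x # xs)} \<longleftrightarrow>
      k \<in> Suc ` {i. i < length xs \<and> j < xs ! i}" for k
    by (cases k) (auto simp: young_diagram_def)
  then have "{i'. i' > 0 \<and> (i', j) \<in> young_diagram (x # xs)} =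
      Suc ` {i. i < length xs \<and> j < xs ! i}" by blast
  moreover have "{j'. j' > j \<and> (0, j') \<in> young_diagram (x # xs)} = {j<..<x}"
    by (auto simp: young_diagram_def)
  ultimately show ?thesis using assms by (simp add: hook_length_def card_image column_def)
qed

text \<open>The head \<open>c + x - 1\<close> minus the gap of column \<open>j\<close> is the hook
  length of box \<open>(0, j)\<close>. The other rows form the tail with charge
  \<open>c - 1\<close>, hence the arbitrary \<open>c\<close>.\<close>

lemma hook_lengths_eq_maya_hooks:
  assumes "is_partition xs"
  shows "hook_length xs ` young_diagram xs = maya_hooks (maya c xs)"
  using assms
proof (induction xs arbitrary: c)
  case Nil
  then show ?case by (simp add: young_diagram_def)
next
  case (Cons x xs)
  have col0: "column (x # xs) j = 0" if "x \<le> j" for j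
    using Cons.prems that by (intro column_eq_0) (auto simp: is_partition_Cons)
  have "{h. h > 0 \<and> c + int x - 1 - int h \<notin> maya c (x # xs)} =
      hook_length (x # xs) ` Pair 0 ` {..<x}"
  proof (intro subset_antisym subsetI)
    fix h assume "h \<in> {h. h > 0 \<and> c + int x - 1 - int h \<notin> maya c (x # xs)}"
    then have "h > 0" "c + int x - 1 - int h \<in> - maya c (x # xs)" by auto
    then obtain j where j: "c + int x - 1 - int h = c + int j - int (column (x # xs) j)"
      unfolding maya_compl[OF Cons.prems] by blast
    \<comment> \<open>For \<open>j \<ge> x\<close> the gap \<open>c + j\<close> lies above the head,
      contradicting \<open>h > 0\<close>.\<close>
    have "j < x" using j col0[of j] \<open>h > 0\<close> by (cases "j < x") simp_all
    moreover from this have "h = hook_length (x # xs) (0, j)"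
      using j by (simp only: hook_length_0 column_Cons) simp
    ultimately show "h \<in> hook_length (x # xs) ` Pair 0 ` {..<x}" by blast
  next
    fix h assume "h \<in> hook_length (x # xs) ` Pair 0 ` {..<x}"
    then obtain j where j: "j < x" "h = x - j + column xs j"
      by (auto simp: hook_length_0)
    then have "c + int x - 1 - int h = c + int j - int (column (x # xs) j)"
      by (simp only: column_Cons) simp
    then have "c + int x - 1 - int h \<in> - maya c (x # xs)"
      unfolding maya_compl[OF Cons.prems] by blast
    then show "h \<in> {h. h > 0 \<and> c + int x - 1 - int h \<notin> maya c (x # xs)}"
      using j by auto
  qed
  moreover have "hook_length (x # xs) ` map_prod Suc id ` young_diagram xs =
      hook_length xs ` young_diagram xs"
    by (force simp: image_image hook_length_Suc split: prod.splits)
  moreover have "hook_length xs ` young_diagram xs = maya_hooks (maya (c - 1) xs)"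
    using Cons by (simp add: is_partition_Cons)
  ultimately show ?case
    unfolding maya_hooks_Cons[OF Cons.prems] young_diagram_Cons image_Un by simp
qed

section \<open>Residue classes\<close>

text \<open>Runner \<open>r\<close> of the \<open>d\<close>-abacus; the partitions of the runners
  form the \<open>d\<close>-quotient.\<close>

definition maya_sect :: "nat \<Rightarrow> int set \<Rightarrow> nat \<Rightarrow> int set" where
  "maya_sect d M r = {m. int d * m + int r \<in> M}"

definition maya_join :: "nat \<Rightarrow> (nat \<Rightarrow> int set) \<Rightarrow> int set" where
  "maya_join d N = {x. x div int d \<in> N (nat (x mod int d))}"

lemma maya_sect_join:
  assumes "r < d"
  shows "maya_sect d (maya_join d N) r = N r"
  using assms by (simp add: maya_sect_def maya_join_def)

lemma maya_join_sect:
  assumes "d > 0"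
  shows "maya_join d (maya_sect d M) = M"
  using assms by (simp add: maya_sect_def maya_join_def)

lemma maya_join_cong:
  assumes "d > 0" "\<And>r. r < d \<Longrightarrow> N r = N' r"
  shows "maya_join d N = maya_join d N'"
proof -
  have "nat (x mod int d) < d" for x using assms(1) by (simp add: nat_less_iff)
  then show ?thesis using assms(2) by (simp add: maya_join_def)
qed

lemma finite_maya_sect:
  assumes "finite S" "d > 0"
  shows "finite (maya_sect d S r)"
proof -
  have "maya_sect d S r = (\<lambda>m. int d * m + int r) -` S" by (auto simp: maya_sect_def)
  then show ?thesis using assms by (auto intro!: finite_vimageI injI)
qed

lemma finite_maya_join:
  assumes "d > 0" "\<And>r. r < d \<Longrightarrow> finite (N r)"
  shows "finite (maya_join d N)"
proof (rule finite_subset)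
  show "maya_join d N \<subseteq> (\<Union>r<d. (\<lambda>m. int d * m + int r) ` N r)"
  proof
    fix x assume "x \<in> maya_join d N"
    then show "x \<in> (\<Union>r<d. (\<lambda>m. int d * m + int r) ` N r)"
      using assms(1) by (auto simp: maya_join_def nat_less_iff image_iff
          intro!: bexI[of _ "nat (x mod int d)"] bexI[of _ "x div int d"])
  qed
  show "finite (\<Union>r<d. (\<lambda>m. int d * m + int r) ` N r)" using assms(2) by auto
qed

text \<open>\<open>m\<close> is the floor of \<open>(d * m + r) / d\<close>. Hence cutting at 0
  commutes with taking residue classes, which lets normalised sums split over the runners.\<close>

lemma residue_nonneg_iff:
  fixes m :: int
  assumes "r < d"
  shows "int d * m + int r \<ge> 0 \<longleftrightarrow> m \<ge> 0"
proof -
  have "int d * m + int r \<ge> 0 \<longleftrightarrow> (int d * m + int r) div int d \<ge> 0"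
    using assms by (intro pos_imp_zdiv_nonneg_iff[symmetric]) simp
  also have "(int d * m + int r) div int d = m" using assms by simp
  finally show ?thesis .
qed

lemma maya_sect_parts:
  assumes "r < d"
  shows "maya_sect d (M \<inter> {0..}) r = maya_sect d M r \<inter> {0..}"
    and "maya_sect d ({..<0} - M) r = {..<0} - maya_sect d M r"
proof -
  show "maya_sect d (M \<inter> {0..}) r = maya_sect d M r \<inter> {0..}"
    by (rule set_eqI) (simp add: maya_sect_def residue_nonneg_iff[OF assms])
  have "int d * m + int r < 0 \<longleftrightarrow> m < 0" for m
    using residue_nonneg_iff[OF assms, of m] by linarith
  then show "maya_sect d ({..<0} - M) r = {..<0} - maya_sect d M r"
    by (intro set_eqI) (simp add: maya_sect_def)
qed

lemma is_maya_sect: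
  assumes "is_maya M" "r < d"
  shows "is_maya (maya_sect d M r)"
  using assms finite_maya_sect[of _ d r] unfolding is_maya_def
  by (simp flip: maya_sect_parts)

lemma is_maya_join:
  assumes "d > 0" "\<And>r. r < d \<Longrightarrow> is_maya (N r)"
  shows "is_maya (maya_join d N)"
proof -
  have "maya_join d N \<inter> {0..} = maya_join d (\<lambda>r. N r \<inter> {0..})"
    "{..<0} - maya_join d N = maya_join d (\<lambda>r. {..<0} - N r)"
    using assms(1) by (auto simp: maya_join_def pos_imp_zdiv_nonneg_iff pos_imp_zdiv_neg_iff)
  then show ?thesis
    using assms by (simp add: is_maya_def finite_maya_join)
qed

lemma sum_residues:
  fixes g :: "int \<Rightarrow> int"
  assumes "finite S" "d > 0"
  shows "sum g S = (\<Sum>r<d. \<Sum>m\<in>maya_sect d S r. g (int d * m + int r))"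
proof -
  have "(\<Sum>r<d. \<Sum>m\<in>maya_sect d S r. g (int d * m + int r)) =
      (\<Sum>(r, m)\<in>Sigma {..<d} (maya_sect d S). g (int d * m + int r))"
    using finite_maya_sect[OF assms] by (simp add: sum.Sigma)
  also have "\<dots> = sum g S"
    by (rule sum.reindex_bij_witness[where j = "\<lambda>(r, m). int d * m + int r"
          and i = "\<lambda>x. (nat (x mod int d), x div int d)"])
      (use assms(2) in \<open>auto simp: maya_sect_def nat_less_iff\<close>)
  finally show ?thesis ..
qed

lemma maya_sum_sect:
  assumes "is_maya M" "d > 0"
  shows "maya_sum g M = (\<Sum>r<d. maya_sum (\<lambda>m. g (int d * m + int r)) (maya_sect d M r))"
  using assms unfolding maya_sum_def sum_subtractf is_maya_def
  by (simp add: sum_residues[of _ d] maya_sect_parts)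

lemma maya_sum_linear:
  "maya_sum (\<lambda>m. a * m + b) M = a * energy M + b * charge M"
  by (simp add: maya_sum_def sum.distrib sum_distrib_left algebra_simps)

text \<open>Moving down by \<open>d * h\<close> keeps the residue modulo \<open>d\<close> and lowers
  the quotient by \<open>h\<close>.\<close>

lemma maya_hooks_sect:
  assumes "d > 0"
  shows "d * h \<in> maya_hooks M \<longleftrightarrow> (\<exists>r<d. h \<in> maya_hooks (maya_sect d M r))"
proof
  assume "d * h \<in> maya_hooks M"
  then obtain x where x: "h > 0" "x \<in> M" "x - int d * int h \<notin> M"
    by (auto simp: maya_hooks_def)
  define r m where "r = nat (x mod int d)" and "m = x div int d"
  have "x = int d * m + int r" "r < d" using assms by (simp_all add: r_def m_def nat_less_iff)
  with x show "\<exists>r<d. h \<in> maya_hooks (maya_sect d M r)"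
    by (auto simp: maya_hooks_def maya_sect_def algebra_simps)
next
  assume "\<exists>r<d. h \<in> maya_hooks (maya_sect d M r)"
  with assms show "d * h \<in> maya_hooks M"
    by (fastforce simp: maya_hooks_def maya_sect_def algebra_simps)
qed

section \<open>The quotient bijection\<close>

definition hook_avoiding :: "nat set \<Rightarrow> nat list set" where
  "hook_avoiding H = {xs. is_partition xs \<and> hook_length xs ` young_diagram xs \<inter> H = {}}"

definition maya_avoiding :: "nat set \<Rightarrow> int set set" where
  "maya_avoiding H = {M. is_maya M \<and> charge M = 0 \<and> maya_hooks M \<inter> H = {}}"

text \<open>These vectors parametrise the \<open>d\<close>-cores; extensionality makes each
  determined by its entries below \<open>d\<close>.\<close>

definition balanced_charges :: "nat \<Rightarrow> (nat \<Rightarrow> int) set" where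
  "balanced_charges d = {c \<in> PiE {..<d} (\<lambda>_. UNIV). (\<Sum>r<d. c r) = 0}"

text \<open>Energy of the diagram whose runners are the vacua \<open>{..<c r}\<close>; for balanced
  \<open>c\<close>, the size of the corresponding \<open>d\<close>-core.\<close>

definition vacuum_energy :: "nat \<Rightarrow> (nat \<Rightarrow> int) \<Rightarrow> int" where
  "vacuum_energy d c = (\<Sum>r<d. int d * energy {..<c r} + int r * c r)"

lemma hook_avoiding_empty: "hook_avoiding {} = {xs. is_partition xs}"
  by (simp add: hook_avoiding_def)

lemma finite_fibers_hook_avoiding: "finite_fibers (hook_avoiding H) sum_list"
  by (rule finite_fibers_inj[OF inj_on_id _ _ finite_fibers_partition]) (auto simp: hook_avoiding_def)

lemma energy_lessThan_0: "energy {..<0} = 0"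
proof -
  have "{..<0} \<inter> {0..} = ({}::int set)" by auto
  then show ?thesis by (simp add: maya_sum_def)
qed

lemma bij_betw_maya: "bij_betw (maya 0) (hook_avoiding H) (maya_avoiding H)"
  unfolding bij_betw_def
proof
  show "inj_on (maya 0) (hook_avoiding H)"
    by (rule inj_onI) (auto simp: hook_avoiding_def intro: maya_inject)
  have "M \<in> maya 0 ` hook_avoiding H" if M: "M \<in> maya_avoiding H" for M
  proof -
    obtain xs where xs: "is_partition xs" "M = maya (charge M) xs"
      using M by (auto simp: maya_avoiding_def intro: maya_surj)
    then have "M = maya 0 xs" using M by (simp add: maya_avoiding_def)
    moreover from this have "xs \<in> hook_avoiding H"
      using M xs(1) hook_lengths_eq_maya_hooks[OF xs(1), of 0]
      by (simp add: hook_avoiding_def maya_avoiding_def)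
    ultimately show ?thesis by blast
  qed
  then show "maya 0 ` hook_avoiding H = maya_avoiding H"
    by (auto simp: hook_avoiding_def maya_avoiding_def charge_maya
        simp flip: hook_lengths_eq_maya_hooks)
qed

lemma nat_energy_maya:
  assumes "xs \<in> hook_avoiding H"
  shows "nat (energy (maya 0 xs)) = sum_list xs"
  using assms by (simp add: hook_avoiding_def energy_maya energy_lessThan_0)

lemma charge_join:
  assumes "d > 0" "\<And>r. r < d \<Longrightarrow> is_partition (L r)"
  shows "charge (maya_join d (\<lambda>r. maya (c r) (L r))) = (\<Sum>r<d. c r)"
proof -
  have "is_maya (maya_join d (\<lambda>r. maya (c r) (L r)))"
    using assms(1) by (simp add: is_maya_join)
  from maya_sum_sect[OF this assms(1), of "\<lambda>_. 1"] show ?thesis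
    using assms by (simp add: maya_sect_join charge_maya)
qed

text \<open>An element \<open>m\<close> of runner \<open>r\<close> contributes
  \<open>d * m + r\<close>, so the runner contributes \<open>d\<close> times its energy plus
  \<open>r\<close> times its charge; \<open>energy_maya\<close> then separates the size of
  \<open>L r\<close>.\<close>

lemma energy_join:
  assumes "d > 0" "\<And>r. r < d \<Longrightarrow> is_partition (L r)"
  shows "energy (maya_join d (\<lambda>r. maya (c r) (L r))) =
    vacuum_energy d c + (\<Sum>r<d. int d * int (sum_list (L r)))"
proof -
  have "is_maya (maya_join d (\<lambda>r. maya (c r) (L r)))"
    using assms(1) by (simp add: is_maya_join)
  from maya_sum_sect[OF this assms(1), of "\<lambda>x. x"] show ?thesis
    using assms
    by (simp add: maya_sect_join maya_sum_linear charge_maya energy_maya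
        vacuum_energy_def distrib_left flip: sum.distrib)
      (simp add: ac_simps)
qed

text \<open>It is the size of the partition whose runners are all vacua, so taking
  \<open>nat\<close> in the weights loses nothing.\<close>

lemma vacuum_energy_nonneg:
  assumes "d > 0" "c \<in> balanced_charges d"
  shows "vacuum_energy d c \<ge> 0"
proof -
  let ?M = "maya_join d (\<lambda>r. maya (c r) [])"
  have M: "is_maya ?M" using assms(1) by (simp add: is_maya_join)
  have "charge ?M = 0"
    using assms charge_join[of d "\<lambda>_. []" c] by (simp add: balanced_charges_def)
  then obtain xs where "is_partition xs" "?M = maya 0 xs"
    using maya_surj[OF M] by metis
  then have "energy ?M \<ge> 0" by (simp only: energy_maya energy_lessThan_0)
  then show ?thesis using assms(1) energy_join[of d "\<lambda>_. []" c] by simp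
qed

text \<open>The charge of runner \<open>r\<close> recovers \<open>c r\<close>, and
  \<open>maya_inject\<close> and \<open>maya_surj\<close> give its partition. Hooks of length
  \<open>d * h\<close> are the hooks of length \<open>h\<close> of the runners, so the avoidance
  conditions match.\<close>

lemma bij_betw_join:
  assumes "d > 0"
  shows "bij_betw (\<lambda>(c, L). maya_join d (\<lambda>r. maya (c r) (L r)))
    (balanced_charges d \<times> PiE {..<d} (\<lambda>_. hook_avoiding H)) (maya_avoiding ((*) d ` H))"
    (is "bij_betw ?f ?A ?B")
proof (rule bij_betw_imageI)
  have part: "is_partition (L r)" if "L \<in> PiE {..<d} (\<lambda>_. hook_avoiding H)" "r < d" for L r
    using that by (auto simp: hook_avoiding_def dest: PiE_mem)
  show "inj_on ?f ?A"
  proof (rule inj_onI, clarify)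
    fix c L c' L'
    assume A: "c \<in> balanced_charges d" "L \<in> PiE {..<d} (\<lambda>_. hook_avoiding H)"
      "c' \<in> balanced_charges d" "L' \<in> PiE {..<d} (\<lambda>_. hook_avoiding H)"
      and eq: "maya_join d (\<lambda>r. maya (c r) (L r)) = maya_join d (\<lambda>r. maya (c' r) (L' r))"
    have "c r = c' r \<and> L r = L' r" if "r < d" for r
    proof -
      have m: "maya (c r) (L r) = maya (c' r) (L' r)"
        using arg_cong[OF eq, of "\<lambda>M. maya_sect d M r"] that by (simp add: maya_sect_join)
      then have "c r = c' r" using part A that by (metis charge_maya)
      with m show ?thesis using part A that by (auto intro: maya_inject)
    qed
    then show "c = c' \<and> L = L'"
      using A PiE_ext[of c "{..<d}" "\<lambda>_. UNIV" c']
        PiE_ext[of L "{..<d}" "\<lambda>_. hook_avoiding H" L']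
      by (simp add: balanced_charges_def)
  qed
  have sub: "?f (c, L) \<in> ?B"
    if "c \<in> balanced_charges d" "L \<in> PiE {..<d} (\<lambda>_. hook_avoiding H)" for c L
  proof -
    have "d * h \<notin> maya_hooks (?f (c, L))" if "h \<in> H" for h
    proof -
      have "h \<notin> maya_hooks (maya (c r) (L r))" if "r < d" for r
        using PiE_mem[OF \<open>L \<in> _\<close>, of r] that \<open>h \<in> H\<close>
          hook_lengths_eq_maya_hooks[of "L r" "c r"] by (auto simp: hook_avoiding_def)
      then show ?thesis by (simp add: maya_hooks_sect[OF assms] maya_sect_join)
    qed
    then show ?thesis
      using that part assms by (auto simp: maya_avoiding_def balanced_charges_def charge_join is_maya_join)
  qed
  have "M \<in> ?f ` ?A" if M: "M \<in> ?B" for M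
  proof -
    define c where "c = (\<lambda>r\<in>{..<d}. charge (maya_sect d M r))"
    have maya: "is_maya M" using M by (simp add: maya_avoiding_def)
    have "\<exists>xs. is_partition xs \<and> maya_sect d M r = maya (charge (maya_sect d M r)) xs" if "r < d" for r
      using maya_surj[OF is_maya_sect[OF maya that]] by metis
    then obtain L0 where L0: "\<And>r. r < d \<Longrightarrow> is_partition (L0 r)"
      "\<And>r. r < d \<Longrightarrow> maya_sect d M r = maya (charge (maya_sect d M r)) (L0 r)"
      by metis
    define L where "L = restrict L0 {..<d}"
    have L: "is_partition (L r)" "maya_sect d M r = maya (c r) (L r)" if "r < d" for r
      using L0 that by (auto simp: L_def c_def)
    have "M = maya_join d (maya_sect d M)" using assms by (simp add: maya_join_sect)
    also have "\<dots> = ?f (c, L)"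
      unfolding prod.case by (rule maya_join_cong[OF assms L(2)])
    finally have eq: "M = ?f (c, L)" .
    have "(\<Sum>r<d. c r) = 0"
      using charge_join[OF assms, of L c] L(1) M eq by (simp add: maya_avoiding_def)
    then have c: "c \<in> balanced_charges d"
      by (simp add: balanced_charges_def c_def)
    have "L r \<in> hook_avoiding H" if "r < d" for r
    proof -
      have "h \<notin> maya_hooks (maya_sect d M r)" if "h \<in> H" for h
        using M that \<open>r < d\<close> maya_hooks_sect[OF assms, of h M] by (auto simp: maya_avoiding_def)
      then show ?thesis
        using L[OF that] hook_lengths_eq_maya_hooks[OF L(1)[OF that], of "c r"]
        by (auto simp: hook_avoiding_def)
    qed
    then have "L \<in> PiE {..<d} (\<lambda>_. hook_avoiding H)" by (auto simp: L_def)
    with eq c show ?thesis by blast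
  qed
  then show "?f ` ?A = ?B" using sub by auto
qed

lemma nat_energy_join:
  assumes "d > 0" "c \<in> balanced_charges d" "L \<in> PiE {..<d} (\<lambda>_. hook_avoiding H)"
  shows "nat (energy (maya_join d (\<lambda>r. maya (c r) (L r)))) =
    nat (vacuum_energy d c) + (\<Sum>r<d. d * sum_list (L r))"
proof -
  have "is_partition (L r)" if "r < d" for r
    using assms(3) that by (auto simp: hook_avoiding_def dest: PiE_mem)
  then have "energy (maya_join d (\<lambda>r. maya (c r) (L r))) =
      vacuum_energy d c + int (\<Sum>r<d. d * sum_list (L r))"
    using assms(1) by (simp add: energy_join)
  then show ?thesis
    using vacuum_energy_nonneg[OF assms(1,2)] by (simp only: nat_add_distrib nat_int of_nat_0_le_iff)
qed

text \<open>Putting the empty partition on every runner embeds the vectors into the diagrams of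
  charge 0, with energy as weight; these correspond to partitions by size.\<close>

lemma finite_fibers_balanced_charges:
  assumes "d > 0"
  shows "finite_fibers (balanced_charges d) (\<lambda>c. nat (vacuum_energy d c))"
proof (rule finite_fibers_inj)
  let ?L = "\<lambda>r\<in>{..<d}. []"
  let ?f = "\<lambda>(c, L). maya_join d (\<lambda>r. maya (c r) (L r))"
  let ?A = "balanced_charges d \<times> PiE {..<d} (\<lambda>_. hook_avoiding {})"
  note bij = bij_betw_join[OF assms, of "{}"]
  have L: "?L \<in> PiE {..<d} (\<lambda>_. hook_avoiding {})" by (simp add: hook_avoiding_empty)
  show "inj_on (\<lambda>c. ?f (c, ?L)) (balanced_charges d)"
  proof (rule inj_onI)
    fix c c' assume "c \<in> balanced_charges d" "c' \<in> balanced_charges d" "?f (c, ?L) = ?f (c', ?L)"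
    then have "(c, ?L) = (c', ?L)"
      using inj_onD[OF bij_betw_imp_inj_on[OF bij]] L by blast
    then show "c = c'" by simp
  qed
  show "(\<lambda>c. ?f (c, ?L)) ` balanced_charges d \<subseteq> maya_avoiding ((*) d ` {})"
    using bij_betw_imp_surj_on[OF bij] L by blast
  show "nat (energy (?f (c, ?L))) = nat (vacuum_energy d c)" if "c \<in> balanced_charges d" for c
    using nat_energy_join[OF assms that L] by simp
  show "finite_fibers (maya_avoiding ((*) d ` {})) (\<lambda>M. nat (energy M))"
    by (rule finite_fibers_bij[where f = "maya 0"], rule bij_betw_maya, rule nat_energy_maya,
        assumption, rule finite_fibers_hook_avoiding)
qed

text \<open>\<open>maya 0\<close> turns size into energy, and \<open>maya_join\<close> splits energy
  into a charge part and \<open>d\<close> times the sizes. The charge factor is the same for every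
  \<open>H\<close>, so \<open>H = {}\<close> will determine it.\<close>

lemma hook_avoiding_gf_quotient:
  assumes "d > 0"
  shows "weight_gf (hook_avoiding ((*) d ` H)) sum_list =
    weight_gf (balanced_charges d) (\<lambda>c. nat (vacuum_energy d c)) *
    (weight_gf (hook_avoiding H) sum_list oo fps_X ^ d) ^ d"
proof -
  let ?P = "PiE {..<d} (\<lambda>_. hook_avoiding H)"
  let ?v = "\<lambda>c. nat (vacuum_energy d c)" and ?w = "\<lambda>L. \<Sum>r<d. d * sum_list (L r)"
  let ?f = "\<lambda>(c, L). maya_join d (\<lambda>r. maya (c r) (L r))"
  have fin: "finite_fibers (hook_avoiding H) (\<lambda>xs. d * sum_list xs)"
    by (rule finite_fibers_scale[OF finite_fibers_hook_avoiding assms])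
  have energy: "nat (energy (?f p)) = (case p of (c, L) \<Rightarrow> ?v c + ?w L)"
    if "p \<in> balanced_charges d \<times> ?P" for p
  proof -
    obtain c L where p: "p = (c, L)" by (cases p)
    show ?thesis
      unfolding p prod.case by (rule nat_energy_join[OF assms]) (use that p in blast)+
  qed
  have "weight_gf (hook_avoiding ((*) d ` H)) sum_list =
      weight_gf (maya_avoiding ((*) d ` H)) (\<lambda>M. nat (energy M))"
    by (rule weight_gf_bij[where f = "maya 0"], rule bij_betw_maya, rule nat_energy_maya)
  also have "\<dots> = weight_gf (balanced_charges d \<times> ?P) (\<lambda>(c, L). ?v c + ?w L)"
    by (rule sym, rule weight_gf_bij[where f = ?f], rule bij_betw_join[OF assms], rule energy)
  also have "\<dots> = weight_gf (balanced_charges d) ?v * weight_gf ?P ?w"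
    by (rule weight_gf_times[OF finite_fibers_balanced_charges[OF assms]])
      (rule conjunct2[OF weight_gf_PiE[OF fin]])
  also have "weight_gf ?P ?w = weight_gf (hook_avoiding H) (\<lambda>xs. d * sum_list xs) ^ d"
    by (rule conjunct1[OF weight_gf_PiE[OF fin]])
  finally show ?thesis by (simp only: weight_gf_scale[OF assms])
qed

section \<open>Cores and elimination of the charge factor\<close>

lemma mod_core_gf_eq: "mod_core_gf s t = weight_gf (hook_avoiding {s + k * t | k. True}) sum_list"
proof -
  have "hook_avoiding {s + k * t | k. True} = {xs. is_mod_core s t xs}"
    unfolding hook_avoiding_def is_mod_core_def by blast
  then show ?thesis
    by (simp add: mod_core_gf_def num_mod_cores_def weight_gf_def)
qed

theorem theorem1p6:
  fixes s t d :: nat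
  assumes "s \<ge> 1" and "t \<ge> 1" and "d = gcd s t"
  shows "mod_core_gf s t =
    qpoch_inf (fps_X ^ d) (fps_X ^ d) ^ d / qpoch_inf fps_X fps_X *
    (fps_compose (mod_core_gf (s div d) (t div d)) (fps_X ^ d)) ^ d"
proof -
  let ?P = "weight_gf (hook_avoiding {}) sum_list" and ?Q = "\<lambda>k. qpoch_inf (fps_X ^ k) (fps_X ^ k)"
  let ?K = "weight_gf (balanced_charges d) (\<lambda>c. nat (vacuum_energy d c))"
  have d: "d > 0" using assms by simp
  have st: "s = d * (s div d)" "t = d * (t div d)" using assms(3) by simp_all
  have "{s + k * t | k. True} = (*) d ` {s div d + k * (t div d) | k. True}"
  proof -
    have "s + k * t = d * (s div d + k * (t div d))" for k
      by (subst st(1), subst st(2)) (simp add: algebra_simps)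
    then show ?thesis by (auto simp: image_def)
  qed
  then have core: "mod_core_gf s t = ?K * (mod_core_gf (s div d) (t div d) oo fps_X ^ d) ^ d"
    by (simp only: mod_core_gf_eq hook_avoiding_gf_quotient[OF d])
  have euler: "?Q k * (?P oo fps_X ^ k) = 1" if "k > 0" for k
    using qpoch_inf_partition_gf[OF that] by (simp only: hook_avoiding_empty)
  have Q1: "?Q 1 * ?P = 1"
    using euler[of 1] by simp
  \<comment> \<open>The case \<open>H = {}\<close> relates the series of all partitions to itself
    through the same \<open>?K\<close>.\<close>
  have P: "?P = ?K * (?P oo fps_X ^ d) ^ d"
    using hook_avoiding_gf_quotient[OF d, of "{}"] by (simp only: image_empty)
  \<comment> \<open>Insert the factor 1 from Euler's product in \<open>q^d\<close>, regroup so that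
    \<open>?K\<close> and the \<open>d\<close>-th power fold into \<open>?P\<close>, then cancel
    \<open>?P\<close> against \<open>?Q 1\<close>.\<close>
  have "?K * ?Q 1 = ?K * (?Q d * (?P oo fps_X ^ d)) ^ d * ?Q 1"
    by (simp only: euler[OF d] power_one mult_1_right)
  also have "\<dots> = (?K * (?P oo fps_X ^ d) ^ d) * ?Q 1 * ?Q d ^ d"
    by (simp only: power_mult_distrib mult_ac)
  also have "\<dots> = ?Q d ^ d"
    by (simp only: P[symmetric] Q1 mult.commute[of ?P] mult_1_left)
  finally have "?Q d ^ d / ?Q 1 = ?K * ?Q 1 / ?Q 1" by (simp only:)
  \<comment> \<open>\<open>?Q 1\<close> is nonzero because \<open>?Q 1 * ?P = 1\<close>.\<close>
  also have "\<dots> = ?K"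
    using Q1 by (intro nonzero_mult_div_cancel_right) auto
  finally show ?thesis using core by (simp only: power_one_right)
qed

end
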